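(* Let $p$ be a prime and let $\alpha,\beta\in\mathbb{N}$ (positive integers) satisfy $\alpha(\beta+1)\leq p-1$. Then there are at least $\alpha(\beta+1)$ distinct elements $a\in\mathbb{F}_p^*$ for which there exist $x\in\{1,2,\ldots,\alpha\}$ and $y\in\{1,2,\ldots,\beta\}$ such that \[ ax\equiv \pm y \pmod{p}. \]
   Context: Here $\mathbb{F}_p^*=\mathbb{F}_p\setminus\{0\}$ denotes the nonzero residues modulo $p$. *)

theory Defs
  imports "HOL-Number_Theory.Number_Theory"
begin

text \<open>The elements of \<open>F\<^sub>p\<^sup>*\<close> are represented by their least positive residues, so
  distinct integers in this set are distinct elements of \<open>F\<^sub>p\<^sup>*\<close>.\<close>

definition nonzero_residues :: "nat \<Rightarrow> int set" where
  "nonzero_residues p = {0..<int p} - {0}"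

end

theory Submission
  imports Defs "HOL-Computational_Algebra.Polynomial"
begin

text \<open>
  This is the Redei-Szonyi direction argument for the grid
  \<open>{0..\<alpha>} \<times> {0..\<beta>}\<close>. If \<open>m\<close> is not of the required form, the
  \<open>n = (\<alpha> + 1)(\<beta> + 1)\<close> numbers \<open>b - a m\<close> are distinct modulo \<open>p\<close>, so \<open>n \<le> p\<close>, and since
  \<open>u\<^sup>p \<equiv> u\<close>, all divided differences of \<open>X\<^sup>p\<close> at three or more of them vanish modulo \<open>p\<close>.
  The divided difference at the points of index \<open>1, \<dots>, k\<close> is the complete homogeneous symmetric
  polynomial (\<open>complete_sym\<close>) of degree \<open>p + 1 - k\<close> in them, hence a polynomial of degree at most \<open>p + 1 - k\<close> in \<open>m\<close>.

  For some \<open>k \<ge> \<alpha>(\<beta> + 1) + 2\<close> it is nonzero at \<open>m = 0\<close>, which leaves at most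
  \<open>p - 1 - \<alpha>(\<beta> + 1)\<close> such \<open>m\<close>. Otherwise \<open>X\<^sup>p\<close> would be congruent, modulo
  \<open>\<Prod>\<^sub>b (X - b)\<^bsup>\<alpha>+1\<^esup>\<close> and \<open>p\<close>, to some \<open>r\<close> of degree at most \<open>\<alpha>(\<beta> + 1) < p\<close>. Then
  \<open>\<Prod>\<^sub>b (X - b)\<^bsup>\<alpha>\<^esup>\<close> divides \<open>r'\<close> modulo \<open>p\<close>, which has smaller degree; so \<open>r\<close> is constant modulo \<open>p\<close>,
  although \<open>r(0) \<equiv> 0\<close> and \<open>r(1) \<equiv> 1\<close>.
\<close>

section \<open>Divided differences of powers as complete homogeneous symmetric polynomials\<close>

fun complete_sym :: "nat \<Rightarrow> 'a::comm_ring_1 list \<Rightarrow> 'a" where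
  "complete_sym 0 us = 1"
| "complete_sym (Suc m) [] = 0"
| "complete_sym (Suc m) (u # us) = complete_sym (Suc m) us + u * complete_sym m (u # us)"

lemma complete_sym_singleton: "complete_sym m [x] = x ^ m"
  by (induction m) auto

text \<open>This is the recursion for divided differences. Started from
  \<open>complete_sym_singleton\<close>, it identifies \<open>complete_sym m us\<close> with the
  divided difference of X^(m + length us - 1) at \<open>us\<close>. No division occurs, so points
  may repeat or be polynomials themselves.\<close>

lemma complete_sym_divided_difference:
  "(x - y) * complete_sym m (x # y # us)
     = complete_sym (Suc m) (x # us) - complete_sym (Suc m) (y # us)"
proof (induction m)
  case 0
  then show ?case by simp
next
  case (Suc m)
  have "(x - y) * complete_sym (Suc m) (x # y # us)
          = (x - y) * complete_sym (Suc m) (y # us) + x * ((x - y) * complete_sym m (x # y # us))"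
    by (simp add: algebra_simps)
  also have "\<dots> = x * complete_sym (Suc m) (x # us) - y * complete_sym (Suc m) (y # us)"
    unfolding Suc.IH by (simp only: algebra_simps)
  finally show ?case by simp
qed

lemma poly_complete_sym:
  "poly (complete_sym m us) y = complete_sym m (map (\<lambda>u. poly u y) us)"
  by (induction m us rule: complete_sym.induct) auto

lemma complete_sym_const:
  "complete_sym m (map (\<lambda>v. [:v:]) vs) = [:complete_sym m vs:]"
  by (induction m vs rule: complete_sym.induct) (auto simp: one_pCons)

lemma degree_complete_sym_le:
  assumes "\<And>u. u \<in> set us \<Longrightarrow> degree u \<le> 1"
  shows "degree (complete_sym m us) \<le> m"
  using assms
proof (induction m us rule: complete_sym.induct)
  case (3 m u us)
  have "degree (u * complete_sym m (u # us)) \<le> degree u + degree (complete_sym m (u # us))"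
    by (rule degree_mult_le)
  also have "\<dots> \<le> Suc m"
    using 3 by (simp add: add_mono[of _ 1 _ m, simplified])
  finally show ?case
    using 3 by (auto intro!: degree_add_le)
qed auto

section \<open>Divided differences of X^p modulo p\<close>

lemma int_power_prime_cong:
  fixes p :: nat and x :: int
  assumes "prime p"
  shows "[x ^ p = x] (mod int p)"
proof -
  define n where "n = nat (x mod int p)"
  have p0: "p > 0" using assms prime_gt_0_nat by blast
  then have x: "[x = int n] (mod int p)"
    unfolding n_def by (simp add: cong_def)
  have "[n ^ p = n] (mod p)"
  proof (cases "p dvd n")
    case True
    then have "p dvd n ^ p" using p0 by (meson dvd_power dvd_trans)
    then show ?thesis using True by (simp add: cong_def)
  next
    case False
    from cong_scalar_left[OF fermat_theorem[OF assms this], of n]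
    show ?thesis using p0 by (simp add: power_eq_if)
  qed
  then have "[int n ^ p = int n] (mod int p)"
    by (simp flip: of_nat_power add: cong_int_iff)
  with x show ?thesis
    by (meson cong_pow cong_sym cong_trans)
qed

text \<open>Modulo p the functions X^p and X agree at every point, and the divided differences of X
  are x, 1, 0, 0, and so on. Distinctness modulo p allows the factor x - y to be cancelled at each
  stage.\<close>

lemma complete_sym_distinct_mod_prime:
  fixes p :: nat and us :: "int list"
  assumes "prime p" and "distinct (map (\<lambda>u. u mod int p) us)"
    and "us \<noteq> []" and "length us \<le> p"
  shows "[complete_sym (p + 1 - length us) us
          = (if length us = 1 then hd us else if length us = 2 then 1 else 0)] (mod int p)"
  using assms(2-4)
proof (induction "length us" arbitrary: us rule: less_induct)
  case less
  show ?case
  proof (cases us rule: remdups_adj.cases)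
    case 1
    then show ?thesis using less.prems by simp
  next
    case (2 x)
    have "[x ^ p = x] (mod int p)"
      using assms(1) by (rule int_power_prime_cong)
    then show ?thesis using 2 by (simp add: complete_sym_singleton)
  next
    case (3 x y vs)
    have nd: "\<not> int p dvd x - y"
      using less.prems(1) 3 by (auto simp: mod_eq_dvd_iff)
    have m: "Suc (p + 1 - length us) = p + 1 - length (x # vs)"
      using less.prems(3) 3 by simp
    let ?c = "\<lambda>u. if vs = [] then u else if length vs = 1 then 1 else (0::int)"
    have "[complete_sym (Suc (p + 1 - length us)) (x # vs) = ?c x] (mod int p)"
      unfolding m using less.hyps[of "x # vs"] less.prems 3 by (auto simp: Suc_le_eq)
    moreover have "[complete_sym (Suc (p + 1 - length us)) (y # vs) = ?c y] (mod int p)"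
      unfolding m using less.hyps[of "y # vs"] less.prems 3 by (auto simp: Suc_le_eq)
    ultimately have "[(x - y) * complete_sym (p + 1 - length us) us = ?c x - ?c y] (mod int p)"
      unfolding 3(1) complete_sym_divided_difference by (rule cong_diff)
    also have "?c x - ?c y = (x - y) * (if length us = 2 then 1 else 0)"
      using 3 by auto
    finally have "[complete_sym (p + 1 - length us) us = (if length us = 2 then 1 else 0)] (mod int p)"
      using nd assms(1) by (simp add: cong_mult_lcancel prime_imp_coprime coprime_commute)
    then show ?thesis using 3 by simp
  qed
qed

section \<open>Newton interpolation, division and roots modulo p\<close>

text \<open>Newton's formula with the nodes taken from the end of \<open>us\<close>: its
  coefficients are the divided differences on suffixes. Those on more than d + 1 points are
  multiples of q and go into \<open>r1\<close>; the others contribute degree at most d to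
  \<open>r0\<close>.\<close>

lemma power_newton_form_mod:
  fixes q :: int and us :: "int list"
  assumes "length us \<le> m"
    and "\<And>xs vs. us = xs @ vs \<Longrightarrow> length vs > Suc d \<Longrightarrow> q dvd complete_sym (m + 1 - length vs) vs"
  shows "\<exists>r0 r1. degree r0 \<le> d \<and>
    [:0, 1:] ^ m = r0 + smult q r1
       + (\<Prod>v\<leftarrow>us. [:- v, 1:]) * complete_sym (m - length us) ([:0, 1:] # map (\<lambda>v. [:v:]) us)"
  using assms
proof (induction us)
  case Nil
  show ?case
    by (rule exI[of _ 0], rule exI[of _ 0]) (simp add: complete_sym_singleton)
next
  case (Cons v vs)
  let ?X = "[:0, 1:] :: int poly" and ?P = "\<Prod>v\<leftarrow>vs. [:- v, 1:]" and ?k = "map (\<lambda>v. [:v:])"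
  define c where "c = complete_sym (m - length vs) (v # vs)"
  have "\<exists>r0 r1. degree r0 \<le> d \<and>
    ?X ^ m = r0 + smult q r1 + ?P * complete_sym (m - length vs) (?X # ?k vs)"
    using Cons.prems by (intro Cons.IH) auto
  then obtain r0 r1 where r: "degree r0 \<le> d"
    "?X ^ m = r0 + smult q r1 + ?P * complete_sym (m - length vs) (?X # ?k vs)" by blast
  have S: "m - length vs = Suc (m - length (v # vs))"
    using Cons.prems(1) by simp
  \<comment> \<open>Applied to the points X and v, the divided difference identity splits the old
    remainder into the next Newton coefficient c and X - v times the new remainder.\<close>
  have "complete_sym (m - length vs) (?X # ?k vs)
      = [:c:] + [:- v, 1:] * complete_sym (m - length (v # vs)) (?X # ?k (v # vs))"
    using complete_sym_divided_difference[of ?X "[:v:]" "m - length (v # vs)" "?k vs"]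
      complete_sym_const[of "m - length vs" "v # vs"]
    unfolding S c_def by simp
  moreover have "?P * ([:c:] + [:- v, 1:] * D) = smult c ?P + ([:- v, 1:] * ?P) * D" for D
  proof -
    have "?P * ([:c:] + [:- v, 1:] * D) = ?P * [:c:] + ([:- v, 1:] * ?P) * D"
      by (simp only: distrib_left mult.assoc mult.left_commute)
    then show ?thesis by simp
  qed
  ultimately have eq: "?X ^ m = r0 + smult q r1 + smult c ?P
      + (\<Prod>v\<leftarrow>v # vs. [:- v, 1:]) * complete_sym (m - length (v # vs)) (?X # ?k (v # vs))"
    using r(2) by (simp only: list.map prod_list.Cons add.assoc)
  show ?case
  proof (cases "length vs > d")
    case True
    have "q dvd c"
      using Cons.prems(2)[of "[]" "v # vs"] True unfolding c_def by simp
    then obtain e where "c = q * e" by blast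
    then show ?thesis
      using r(1) eq by (intro exI[of _ r0] exI[of _ "r1 + smult e ?P"]) (simp add: smult_add_right)
  next
    case False
    have "degree ?P \<le> length vs"
      by (induction vs) (auto intro: order_trans[OF degree_mult_le] simp del: mult_pCons_left)
    then have "degree (r0 + smult c ?P) \<le> d"
      using r(1) False by (intro degree_add_le order_trans[OF degree_smult_le]) auto
    then show ?thesis
      using eq by (intro exI[of _ "r0 + smult c ?P"] exI[of _ r1]) (simp add: algebra_simps)
  qed
qed

text \<open>Division of t by the monic M gives t = M * u + v, so M divides q v - r, which has
  smaller degree than M and therefore vanishes. Pseudo-division is true division here.\<close>

lemma monic_mult_eq_smult_add:
  fixes M s t r :: "int poly"
  assumes "lead_coeff M = 1" and "degree r < degree M" and "M * s + r = smult q t"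
  shows "\<exists>t'. r = smult q t'"
proof -
  have "M \<noteq> 0" using assms(1) by auto
  obtain u v where uv: "pseudo_divmod t M = (u, v)" by fastforce
  have t: "t = M * u + v" and v: "v = 0 \<or> degree v < degree M"
    using pseudo_divmod[OF \<open>M \<noteq> 0\<close> uv] assms(1) by auto
  have eq: "M * (s - smult q u) = smult q v - r"
    using assms(3) t by (simp add: algebra_simps smult_add_right)
  have "degree (smult q v - r) < degree M"
    using v assms(2) by (intro degree_diff_less order_le_less_trans[OF degree_smult_le]) auto
  then have "s - smult q u = 0"
    using eq \<open>M \<noteq> 0\<close> by (metis degree_mult_eq le_add1 not_le)
  then show ?thesis using eq by auto
qed

text \<open>Splitting off a root c leaves a quotient that is still nonzero at \<open>a\<close>
  modulo p and, p being prime, retains all other roots. One value prime to p certifies that P is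
  nonzero modulo p.\<close>

lemma card_poly_roots_mod_prime_le:
  fixes P :: "int poly"
  assumes "prime p" and "\<not> int p dvd poly P a"
  shows "card {m \<in> {0..<int p}. int p dvd poly P m} \<le> degree P"
  using assms(2)
proof (induction "degree P" arbitrary: P)
  case 0
  then obtain c where "P = [:c:]" by (metis degree_eq_zeroE)
  then show ?case using 0 by simp
next
  case (Suc n)
  let ?R = "\<lambda>P. {m \<in> {0..<int p}. int p dvd poly P m}"
  have fin: "finite (?R P)" for P
    by (rule finite_subset[of _ "{0..<int p}"]) auto
  show ?case
  proof (cases "?R P = {}")
    case False
    then obtain c where c: "0 \<le> c" "c < int p" "int p dvd poly P c" by auto
    define Q where "Q = synthetic_div P c"
    have PQ: "poly P x = (x - c) * poly Q x + poly P c" for x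
      using arg_cong[OF synthetic_div_correct'[of c P], of "\<lambda>P. poly P x"]
      unfolding Q_def by (simp add: algebra_simps)
    have degQ: "degree Q = n"
      using Suc.hyps(2) unfolding Q_def degree_synthetic_div by simp
    have "\<not> int p dvd poly Q a"
      using Suc.prems PQ[of a] c(3) by auto
    then have "card (?R Q) \<le> n"
      using Suc.hyps(1)[of Q] degQ by simp
    moreover have "?R P \<subseteq> insert c (?R Q)"
    proof
      fix x assume x: "x \<in> ?R P"
      then have "int p dvd (x - c) * poly Q x"
        using PQ[of x] c(3) by (auto simp: dvd_add_left_iff)
      then have "int p dvd x - c \<or> int p dvd poly Q x"
        using assms(1) by (simp add: prime_dvd_mult_iff)
      moreover have "x = c" if "int p dvd x - c"
        using that x c by (auto simp: mod_eq_dvd_iff[symmetric])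
      ultimately show "x \<in> insert c (?R Q)" using x by auto
    qed
    ultimately show ?thesis
      using card_mono[of "insert c (?R Q)" "?R P"]
        Suc.hyps(2) fin by (simp add: card_insert_if split: if_splits)
  next
    case True
    then show ?thesis by (simp only: card.empty le0)
  qed
qed

section \<open>Nonvanishing at m = 0\<close>

lemma prod_list_product_snd:
  fixes f :: "'b \<Rightarrow> 'c::comm_monoid_mult"
  shows "(\<Prod>z\<leftarrow>List.product xs ys. f (snd z)) = (\<Prod>y\<leftarrow>ys. f y) ^ length xs"
  by (induction xs) (auto simp: o_def)

text \<open>The list \<open>us\<close> holds the values of b - a m at m = 0, so each b occurs
  \<alpha> + 1 times. Suffixes appear because the Newton form is built on them.\<close>

lemma complete_sym_repeated_nonzero:
  fixes p \<alpha> \<beta> :: nat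
  defines "us \<equiv> map (\<lambda>z. int (snd z)) (List.product [0..<\<alpha> + 1] [0..<\<beta> + 1])"
  assumes "prime p" and "\<alpha> \<ge> 1" and "\<beta> \<ge> 1" and "(\<alpha> + 1) * (\<beta> + 1) \<le> p"
  shows "\<exists>xs vs. us = xs @ vs \<and> length vs \<ge> \<alpha> * (\<beta> + 1) + 2
           \<and> \<not> int p dvd complete_sym (p + 1 - length vs) vs"
proof (rule ccontr)
  assume contra: "\<not> ?thesis"
  define d where "d = \<alpha> * (\<beta> + 1)"
  define L where "L = (\<Prod>b\<leftarrow>[0..<\<beta> + 1]. [:- int b, 1:])"
  define M where "M = L ^ \<alpha>"
  have d: "0 < d" "d < p"
    using assms(3-5) unfolding d_def by auto
  have len: "length us \<le> p"
    using assms(5) unfolding us_def by (simp add: length_product)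
  have dv: "int p dvd complete_sym (p + 1 - length vs) vs" if "us = xs @ vs" "length vs > Suc d" for xs vs
    using that contra unfolding d_def by auto
  have "\<exists>r0 r1. degree r0 \<le> d \<and>
    [:0, 1:] ^ p = r0 + smult (int p) r1
       + (\<Prod>v\<leftarrow>us. [:- v, 1:]) * complete_sym (p - length us) ([:0, 1:] # map (\<lambda>v. [:v:]) us)"
    by (rule power_newton_form_mod[OF len]) (rule dv)
  then obtain r0 r1 s where r0: "degree r0 \<le> d"
    and eq: "[:0, 1:] ^ p = r0 + smult (int p) r1 + (\<Prod>v\<leftarrow>us. [:- v, 1:]) * s"
    by (elim exE conjE) (rule that)
  have "(\<Prod>v\<leftarrow>us. [:- v, 1:]) = L ^ Suc \<alpha>"
    using prod_list_product_snd[of "\<lambda>b. [:- int b, 1:]" "[0..<\<alpha> + 1]" "[0..<\<beta> + 1]"]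
    unfolding us_def L_def by (simp add: o_def)
  note eq = eq[unfolded this]
  have monic: "lead_coeff (\<Prod>b\<leftarrow>bs. [:- int b, 1:]) = 1 \<and> degree (\<Prod>b\<leftarrow>bs. [:- int b, 1:]) = length bs" for bs
  proof (induction bs)
    case (Cons b bs)
    then have "(\<Prod>b\<leftarrow>bs. [:- int b, 1:]) \<noteq> 0" by auto
    moreover have lc: "lead_coeff (\<Prod>b\<leftarrow>bs. [:- int b, 1:]) = 1"
      and deg: "degree (\<Prod>b\<leftarrow>bs. [:- int b, 1:]) = length bs"
      using Cons by blast+
    have "lead_coeff ([:- int b, 1:] * (\<Prod>b\<leftarrow>bs. [:- int b, 1:])) = 1"
      unfolding lead_coeff_mult lc by simp
    moreover have "degree ([:- int b, 1:] * (\<Prod>b\<leftarrow>bs. [:- int b, 1:])) = length (b # bs)"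
      using calculation deg by (subst degree_mult_eq) auto
    ultimately show ?case
      unfolding list.map prod_list.Cons by blast
  qed simp
  have lcL: "lead_coeff L = 1" "degree L = \<beta> + 1"
    using monic[of "[0..<\<beta> + 1]"] unfolding L_def by auto
  then have "L \<noteq> 0" by auto
  then have M: "lead_coeff M = 1" "degree M = d"
    unfolding M_def d_def lead_coeff_power lcL(1) by (simp_all add: degree_power_eq lcL(2))
  \<comment> \<open>The derivative of X^p vanishes modulo p, and that of L^(\<alpha>+1) * s keeps
    the factor M = L^\<alpha>. Hence M divides the derivative of \<open>r0\<close> modulo p.\<close>
  have "pderiv ([:0, 1:] ^ p) = smult (int p) ([:0, 1:] ^ (p - 1))"
    using d(2) by (cases p) (auto simp: pderiv_power_Suc pderiv_pCons simp del: power_Suc)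
  moreover have "pderiv ([:0, 1:] ^ p) = pderiv r0 + smult (int p) (pderiv r1)
      + M * (smult (int (Suc \<alpha>)) (pderiv L * s) + L * pderiv s)"
    unfolding eq M_def pderiv_add pderiv_mult pderiv_smult pderiv_power_Suc
    by (simp add: algebra_simps)
  ultimately have "M * (smult (int (Suc \<alpha>)) (pderiv L * s) + L * pderiv s) + pderiv r0
      = smult (int p) ([:0, 1:] ^ (p - 1) - pderiv r1)"
    by (simp add: smult_diff_right algebra_simps)
  moreover have "degree (pderiv r0) < degree M"
    using r0 d(1) by (simp add: degree_pderiv M(2))
  ultimately obtain t where t: "pderiv r0 = smult (int p) t"
    using monic_mult_eq_smult_add[OF M(1)] by blast
  \<comment> \<open>The factors i + 1 \<le> d < p introduced by differentiation are invertible
    modulo p, so every nonconstant coefficient vanishes.\<close>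
  have coeff: "int p dvd coeff r0 (Suc i)" for i
  proof (cases "i < d")
    case True
    have "int (Suc i) * coeff r0 (Suc i) = int p * coeff t i"
      using arg_cong[OF t, of "\<lambda>P. coeff P i"] by (simp add: coeff_pderiv)
    then have "int p dvd int (Suc i) * coeff r0 (Suc i)" by simp
    moreover have "\<not> int p dvd int (Suc i)"
      using True d(2) by (auto dest!: dvd_imp_le simp flip: of_nat_Suc)
    ultimately show ?thesis
      using assms(2) by (simp add: prime_dvd_mult_iff del: of_nat_Suc)
  next
    case False
    then show ?thesis using r0 by (simp add: coeff_eq_0)
  qed
  have "int p dvd poly r0 1 - poly r0 0"
  proof -
    obtain a r where r: "r0 = pCons a r" by (cases r0)
    have "int p dvd poly r 1"
      unfolding poly_altdef using coeff r by (auto intro!: dvd_sum)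
    then show ?thesis using r by simp
  qed
  moreover have root: "poly L (int j) = 0" if "j \<le> \<beta>" for j
  proof -
    have "poly (\<Prod>b\<leftarrow>bs. [:- int b, 1:]) x = (\<Prod>b\<leftarrow>bs. x - int b)" for bs x
      by (induction bs) (auto simp: algebra_simps)
    with that show ?thesis
      unfolding L_def by (auto simp: prod_list_zero_iff image_iff simp del: upt_Suc)
  qed
  \<comment> \<open>Since \<beta> \<ge> 1, both 0 and 1 are roots of L, so \<open>r0\<close> agrees
    with X^p there modulo p.\<close>
  have "poly L 0 = 0" "poly L 1 = 0"
    using root[of 0] root[of 1] assms(4) by auto
  then have "0 = poly r0 0 + int p * poly r1 0" "1 = poly r0 1 + int p * poly r1 1"
    using arg_cong[OF eq, of "\<lambda>P. poly P 0"] arg_cong[OF eq, of "\<lambda>P. poly P 1"] d(2)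
    by (auto simp: poly_power zero_power)
  then have "poly r0 1 - poly r0 0 = 1 + int p * (poly r1 0 - poly r1 1)"
    by (simp add: algebra_simps)
  ultimately have "int p dvd 1"
    by (metis dvd_add_left_iff dvd_triv_left)
  then show False using assms(2) by (auto simp: prime_nat_iff)
qed

section \<open>Grid values and the final count\<close>

text \<open>A coincidence b - a m = b' - a' m modulo p with a > a' gives m (a - a') = b - b'. This
  is an excluded relation with x = a - a' and y = |b - b'|, unless b = b', when p would divide m or
  a - a'.\<close>

lemma distinct_grid_mod:
  fixes p \<alpha> \<beta> :: nat and m :: int
  assumes "prime p" and "\<alpha> < p" and "\<beta> < p" and "\<not> int p dvd m"
    and bad: "\<And>x y. x \<in> {1..\<alpha>} \<Longrightarrow> y \<in> {1..\<beta>} \<Longrightarrow>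
      \<not> ([m * int x = int y] (mod int p) \<or> [m * int x = - int y] (mod int p))"
  shows "distinct (map (\<lambda>(a, b). (int b - int a * m) mod int p) (List.product [0..<\<alpha> + 1] [0..<\<beta> + 1]))"
proof -
  have aux: False if "a \<le> \<alpha>" "a' < a" "b \<le> \<beta>" "b' \<le> \<beta>"
    and "[int b - int a * m = int b' - int a' * m] (mod int p)" for a a' b b'
  proof -
    have dv: "int p dvd m * int (a - a') - (int b - int b')"
    proof -
      have "int p dvd (int b - int a * m) - (int b' - int a' * m)"
        using that(5) by (simp add: cong_iff_dvd_diff)
      then have "int p dvd - ((int b - int a * m) - (int b' - int a' * m))"
        by (simp only: dvd_minus_iff)
      then show ?thesis using that(2) by (simp add: of_nat_diff algebra_simps)
    qed
    have x: "a - a' \<in> {1..\<alpha>}" using that by auto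
    consider "b = b'" | "b' < b" | "b < b'" by linarith
    then show False
    proof cases
      case 1
      then have "int p dvd m \<or> int p dvd int (a - a')"
        using dv assms(1) by (simp add: prime_dvd_mult_iff del: of_nat_diff)
      then show ?thesis
        using assms(2,4) x by (auto dest: dvd_imp_le)
    next
      case 2
      then have "[m * int (a - a') = int (b - b')] (mod int p)"
        using dv by (simp add: cong_iff_dvd_diff of_nat_diff)
      moreover have "b - b' \<in> {1..\<beta>}" using 2 that by auto
      ultimately show ?thesis using bad[OF x] by blast
    next
      case 3
      then have "[m * int (a - a') = - int (b' - b)] (mod int p)"
        using dv by (simp add: cong_iff_dvd_diff of_nat_diff)
      moreover have "b' - b \<in> {1..\<beta>}" using 3 that by auto
      ultimately show ?thesis using bad[OF x] by blast
    qed
  qed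
  have "inj_on (\<lambda>(a, b). (int b - int a * m) mod int p) ({..\<alpha>} \<times> {..\<beta>})"
  proof (rule inj_onI, clarsimp)
    fix a b a' b'
    assume ab: "a \<le> \<alpha>" "b \<le> \<beta>" "a' \<le> \<alpha>" "b' \<le> \<beta>"
      and eq: "(int b - int a * m) mod int p = (int b' - int a' * m) mod int p"
    have "a = a'"
      using aux[of a a' b b'] aux[of a' a b' b] ab eq by (metis cong_def nat_neq_iff)
    moreover from this eq have "[int b = int b'] (mod int p)"
      by (simp add: cong_iff_dvd_diff mod_eq_dvd_iff)
    then have "b = b'"
      using ab assms(3) by (simp add: cong_def)
    ultimately show "a = a' \<and> b = b'" by simp
  qed
  moreover have "set (List.product [0..<\<alpha> + 1] [0..<\<beta> + 1]) = {..\<alpha>} \<times> {..\<beta>}"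
    by (auto simp: less_Suc_eq_le)
  ultimately show ?thesis
    by (simp only: distinct_map distinct_product distinct_upt simp_thms)
qed

theorem theorem2:
  fixes p \<alpha> \<beta> :: nat
  assumes "prime p" and "\<alpha> \<ge> 1" and "\<beta> \<ge> 1" and "\<alpha> * (\<beta> + 1) \<le> p - 1"
  shows "card {a \<in> nonzero_residues p.
            \<exists>x\<in>{1..\<alpha>}. \<exists>y\<in>{1..\<beta>}.
              [a * int x = int y] (mod int p) \<or> [a * int x = - int y] (mod int p)}
         \<ge> \<alpha> * (\<beta> + 1)"
proof -
  let ?good = "\<lambda>a. \<exists>x\<in>{1..\<alpha>}. \<exists>y\<in>{1..\<beta>}.
              [a * int x = int y] (mod int p) \<or> [a * int x = - int y] (mod int p)"
  define bad where "bad = {a \<in> nonzero_residues p. \<not> ?good a}"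
  \<comment> \<open>The grid values as linear polynomials in m, so that one polynomial can be
    evaluated both at bad m and at 0.\<close>
  define nodes where
    "nodes = map (\<lambda>(a, b). [:int b, - int a:]) (List.product [0..<\<alpha> + 1] [0..<\<beta> + 1])"
  have len: "length nodes = (\<alpha> + 1) * (\<beta> + 1)"
    unfolding nodes_def by (simp add: length_product)
  have p0: "p > 0" using assms(1) prime_gt_0_nat by blast
  have lt: "\<alpha> < p" "\<beta> < p"
  proof -
    have "\<alpha> * 1 \<le> \<alpha> * (\<beta> + 1)" "1 * (\<beta> + 1) \<le> \<alpha> * (\<beta> + 1)"
      using assms(2) by (intro mult_le_mono; simp)+
    then show "\<alpha> < p" "\<beta> < p"
      using assms(4) p0 by auto
  qed
  have dist: "distinct (map (\<lambda>u. u mod int p) (map (\<lambda>u. poly u m) nodes))" if "m \<in> bad" for m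
  proof -
    have "\<not> int p dvd m"
      using that unfolding bad_def nonzero_residues_def by (auto dest: zdvd_imp_le)
    with that have "distinct (map (\<lambda>(a, b). (int b - int a * m) mod int p)
        (List.product [0..<\<alpha> + 1] [0..<\<beta> + 1]))"
      by (intro distinct_grid_mod[OF assms(1) lt]) (auto simp: bad_def)
    then show ?thesis
      unfolding nodes_def by (simp add: o_def case_prod_unfold mult.commute)
  qed
  have "card bad \<le> p - 1 - \<alpha> * (\<beta> + 1)"
  proof (cases "length nodes \<le> p")
    case True
    have "map (\<lambda>u. poly u 0) nodes = map (\<lambda>z. int (snd z)) (List.product [0..<\<alpha> + 1] [0..<\<beta> + 1])"
      unfolding nodes_def by auto
    then obtain xs vs where split: "map (\<lambda>u. poly u 0) nodes = xs @ vs"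
      and k: "length vs \<ge> \<alpha> * (\<beta> + 1) + 2"
      and nz: "\<not> int p dvd complete_sym (p + 1 - length vs) vs"
      using complete_sym_repeated_nonzero[OF assms(1-3)] True len by metis
    \<comment> \<open>The suffix found at m = 0 lifts to a suffix of linear polynomials; its length
      does not depend on m.\<close>
    then obtain us ws where nodes: "nodes = us @ ws" and vs: "vs = map (\<lambda>u. poly u 0) ws"
      by (auto simp: map_eq_append_conv)
    define P where "P = complete_sym (p + 1 - length ws) ws"
    have "degree P \<le> p + 1 - length ws"
      unfolding P_def
    proof (rule degree_complete_sym_le)
      fix u assume "u \<in> set ws"
      then have "u \<in> set nodes" using nodes by simp
      then show "degree u \<le> 1" unfolding nodes_def by auto
    qed
    have "bad \<subseteq> {m \<in> {0..<int p}. int p dvd poly P m}"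
    proof
      fix m assume m: "m \<in> bad"
      \<comment> \<open>At least three points are needed for the divided difference to be 0 rather
        than 1 or the point itself.\<close>
      have "3 \<le> length ws"
        using k vs assms(2,3) by simp
      moreover have "length ws \<le> p" using True nodes by simp
      ultimately have "[complete_sym (p + 1 - length ws) (map (\<lambda>u. poly u m) ws) = 0] (mod int p)"
        using complete_sym_distinct_mod_prime[OF assms(1), of "map (\<lambda>u. poly u m) ws"]
          dist[OF m] nodes by fastforce
      then show "m \<in> {m \<in> {0..<int p}. int p dvd poly P m}"
        using m unfolding P_def bad_def nonzero_residues_def
        by (auto simp: poly_complete_sym cong_0_iff)
    qed
    moreover have "finite {m \<in> {0..<int p}. int p dvd poly P m}"
      by (rule finite_subset[of _ "{0..<int p}"]) auto
    ultimately have "card bad \<le> card {m \<in> {0..<int p}. int p dvd poly P m}"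
      by (rule card_mono[rotated])
    also have "\<dots> \<le> degree P"
      using nz vs by (intro card_poly_roots_mod_prime_le[OF assms(1), of _ 0])
        (simp add: P_def poly_complete_sym)
    also have "\<dots> \<le> p + 1 - length ws" by fact
    \<comment> \<open>The two extra points in \<open>k\<close> turn p + 1 into the required p -
      1.\<close>
    finally show ?thesis using k vs by simp
  next
    case False
    \<comment> \<open>Pigeonhole: more than p grid values cannot be distinct modulo p.\<close>
    have "m \<notin> bad" for m
    proof
      assume "m \<in> bad"
      let ?us = "map (\<lambda>u. u mod int p) (map (\<lambda>u. poly u m) nodes)"
      have "card (set ?us) \<le> card {0..<int p}"
        using p0 by (intro card_mono) auto
      then have "length nodes \<le> p"
        using distinct_card[OF dist[OF \<open>m \<in> bad\<close>]] by simp
      then show False using False by simp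
    qed
    then have "bad = {}" by blast
    then show ?thesis by simp
  qed
  moreover have "card (nonzero_residues p) = p - 1"
    using p0 unfolding nonzero_residues_def by (simp add: card_Diff_subset)
  moreover have "{a \<in> nonzero_residues p. ?good a} = nonzero_residues p - bad"
    unfolding bad_def by blast
  moreover have "bad \<subseteq> nonzero_residues p"
    unfolding bad_def by blast
  moreover from this have "finite bad"
    by (rule finite_subset) (simp add: nonzero_residues_def)
  ultimately show ?thesis
    using assms(4) by (simp add: card_Diff_subset)
qed

end
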